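(* Let $S\subseteq\mathbb{Z}^{+}$ and let $n\ge 0$ be an integer. Then $$F_{n,S}=\frac12\sum_{k=0}^\infty\frac{1}{2^k}\sum_{\ell=0}^n{n\brace \ell}_S (k)_\ell .$$
   Context: $\mathbb{Z}^{+}$ is the set of positive integers. For $S\subseteq\mathbb{Z}^{+}$, ${n\brace k}_S$ denotes the number of partitions of $[n]=\{1,\dots,n\}$ into exactly $k$ (non-empty) blocks such that the size of each block belongs to $S$ (so ${0\brace 0}_S=1$). The $S$-restricted Fubini number $F_{n,S}$ is the number of ordered set partitions of $[n]$ (the order of the blocks matters) all of whose block sizes belong to $S$, i.e. $F_{n,S}=\sum_{k=0}^n k!{n\brace k}_S$. $(k)_\ell=k(k-1)\cdots(k-\ell+1)$ is the falling factorial, with $(k)_0=1$. *)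

theory Defs
  imports Complex_Main "HOL-Library.Disjoint_Sets" "HOL-Combinatorics.Multiset_Permutations"
begin

definition restricted_partitions :: "nat set \<Rightarrow> nat \<Rightarrow> nat \<Rightarrow> nat set set set" where
  "restricted_partitions S n k =
     {P. partition_on {1..n} P \<and> card P = k \<and> (\<forall>B\<in>P. card B \<in> S)}"

definition restricted_Stirling :: "nat set \<Rightarrow> nat \<Rightarrow> nat \<Rightarrow> nat" where
  "restricted_Stirling S n k = card (restricted_partitions S n k)"

text \<open>An ordered set partition is the list of its pairwise distinct blocks.\<close>

definition ordered_restricted_partitions :: "nat set \<Rightarrow> nat \<Rightarrow> nat set list set" where
  "ordered_restricted_partitions S n =
     {Bs. distinct Bs \<and> partition_on {1..n} (set Bs) \<and> (\<forall>B\<in>set Bs. card B \<in> S)}"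

definition restricted_Fubini :: "nat set \<Rightarrow> nat \<Rightarrow> nat" where
  "restricted_Fubini S n = card (ordered_restricted_partitions S n)"

definition falling_factorial :: "nat \<Rightarrow> nat \<Rightarrow> real" where
  "falling_factorial k l = (\<Prod>i<l. real k - real i)"

lemma finite_restricted_partitions: "finite (restricted_partitions S n k)"
proof (rule finite_subset)
  show "restricted_partitions S n k \<subseteq> Pow (Pow {1..n})"
    by (auto simp: restricted_partitions_def partition_on_def)
qed simp

lemma card_partition_on_le:
  assumes "finite A" "partition_on A P"
  shows "card P \<le> card A"
proof -
  have fin: "finite P" using assms by (rule finite_elements)
  have "card A = (\<Sum>B\<in>P. card B)"
    using assms by (metis product_partition rev_finite_subset Union_upper partition_onD1 partition_onD2
      card_Union_disjoint disjoint_def pairwise_def)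
  moreover have "(\<Sum>B\<in>P. 1) \<le> (\<Sum>B\<in>P. card B)"
  proof (rule sum_mono)
    fix B assume B: "B \<in> P"
    then have "B \<noteq> {}" "finite B"
      using assms by (auto simp: partition_on_def intro: finite_subset)
    then show "1 \<le> card B" by (simp add: Suc_le_eq card_gt_0_iff)
  qed
  ultimately show ?thesis by simp
qed

lemma restricted_Fubini_eq_sum:
  "restricted_Fubini S n = (\<Sum>k=0..n. fact k * restricted_Stirling S n k)"
proof -
  let ?R = "restricted_partitions S n"
  have fin: "finite P" if "P \<in> ?R k" for P k
    using that finite_elements[of "{1..n}" P] by (auto simp: restricted_partitions_def)
  have eq: "ordered_restricted_partitions S n =
      (\<Union>k\<in>{0..n}. \<Union>P\<in>?R k. permutations_of_set P)"
    using card_partition_on_le[of "{1..n}"]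
    by (fastforce simp: ordered_restricted_partitions_def restricted_partitions_def
        permutations_of_set_def)
  have inner: "card (\<Union>P\<in>?R k. permutations_of_set P) = fact k * restricted_Stirling S n k" for k
  proof -
    have "card (\<Union>P\<in>?R k. permutations_of_set P) = (\<Sum>P\<in>?R k. card (permutations_of_set P))"
      using finite_restricted_partitions by (intro card_UN_disjoint) (auto dest: permutations_of_setD)
    also have "\<dots> = (\<Sum>P\<in>?R k. fact k)"
      using fin by (intro sum.cong) (auto simp: restricted_partitions_def)
    finally show ?thesis by (simp add: restricted_Stirling_def)
  qed
  have "restricted_Fubini S n = (\<Sum>k=0..n. card (\<Union>P\<in>?R k. permutations_of_set P))"
    unfolding restricted_Fubini_def eq
    using finite_restricted_partitions
    by (intro card_UN_disjoint) (auto dest: permutations_of_setD simp: restricted_partitions_def)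
  then show ?thesis by (simp add: inner)
qed

end

theory Submission
  imports Defs "HOL-Real_Asymp.Real_Asymp"
begin

text \<open>
  Since \<open>F\<close> is the sum of \<open>l!\<close> times the restricted Stirling numbers, it suffices to evaluate
  \<open>\<Sum>k. (k)\<^sub>l / 2\<^sup>k = 2 l!\<close> and sum over the finitely many \<open>l\<close>. More generally the
  partial sums of \<open>\<Sum>k. (k)\<^sub>l x\<^sup>k\<close> satisfy a recurrence in \<open>l\<close> because
  \<open>(k + 1)\<^sub>l\<^sub>+\<^sub>1 = (k)\<^sub>l\<^sub>+\<^sub>1 + (l + 1) (k)\<^sub>l\<close>, and its boundary term vanishes
  for \<open>\<bar>x\<bar> < 1\<close>.
\<close>

lemma falling_factorial_Suc: "falling_factorial k (Suc l) = falling_factorial k l * (real k - real l)"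
  by (simp add: falling_factorial_def)

text \<open>Splitting off the factor for \<open>i = 0\<close> leaves \<open>k + 1\<close> times the
  falling factorial of \<open>k\<close> of length \<open>l\<close>; then
  \<open>k + 1 = (k - l) + (l + 1)\<close>.\<close>

lemma falling_factorial_Suc_Suc:
  "falling_factorial (Suc k) (Suc l) =
     falling_factorial k (Suc l) + real (Suc l) * falling_factorial k l"
proof -
  have "falling_factorial (Suc k) (Suc l) = real (Suc k) * falling_factorial k l"
    unfolding falling_factorial_def by (subst prod.lessThan_Suc_shift) simp
  then show ?thesis by (simp add: falling_factorial_Suc algebra_simps)
qed

text \<open>A crude bound, polynomial in \<open>k\<close> for fixed \<open>l\<close>, is enough
  against geometric decay.\<close>

lemma abs_falling_factorial_le: "\<bar>falling_factorial k l\<bar> \<le> real (k + l) ^ l"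
proof -
  have "\<bar>falling_factorial k l\<bar> = (\<Prod>i<l. \<bar>real k - real i\<bar>)"
    by (simp add: falling_factorial_def abs_prod)
  also have "\<dots> \<le> (\<Prod>i<l. real (k + l))"
    by (intro prod_mono) auto
  finally show ?thesis by simp
qed

lemma falling_factorial_times_power_tendsto_0:
  fixes x :: real
  assumes "\<bar>x\<bar> < 1"
  shows "(\<lambda>k. falling_factorial k l * x ^ k) \<longlonglongrightarrow> 0"
proof (cases "x = 0")
  case True
  \<comment> \<open>Since \<open>0 ^ 0 = 1\<close>, the index \<open>k = 0\<close> is left
    out.\<close>
  have "\<forall>\<^sub>F k in sequentially. falling_factorial k l * x ^ k = 0"
    using eventually_gt_at_top[of 0] by eventually_elim (simp add: True)
  then show ?thesis by (rule tendsto_eventually)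
next
  case False
  \<comment> \<open>Passing to the absolute value gives \<open>real_asymp\<close> a positive
    base.\<close>
  define c where "c = \<bar>x\<bar>"
  have c: "0 < c" "c < 1" using False assms by (auto simp: c_def)
  have lim: "(\<lambda>k. real (k + l) ^ l * c ^ k) \<longlonglongrightarrow> 0"
    using c by real_asymp
  show ?thesis
  proof (rule tendsto_0_le[OF lim, where K = 1], intro always_eventually allI)
    fix k
    have "\<bar>falling_factorial k l\<bar> * c ^ k \<le> real (k + l) ^ l * c ^ k"
      using c by (intro mult_right_mono abs_falling_factorial_le) simp
    then show "norm (falling_factorial k l * x ^ k) \<le> norm (real (k + l) ^ l * c ^ k) * 1"
      by (simp add: abs_mult power_abs c_def)
  qed
qed

lemma falling_factorial_power_sums:
  fixes x :: real
  assumes x: "\<bar>x\<bar> < 1"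
  shows "(\<lambda>k. falling_factorial k l * x ^ k) sums (fact l * x ^ l / (1 - x) ^ Suc l)"
proof (induction l)
  case 0
  then show ?case using geometric_sums[of x] x by (simp add: falling_factorial_def)
next
  case (Suc l)
  let ?a = "\<lambda>l k. falling_factorial k l * x ^ k"
  have partial: "(\<Sum>k<N. ?a (Suc l) k) =
      (real (Suc l) * x * (\<Sum>k<N. ?a l k) - ?a (Suc l) N) / (1 - x)" for N
  proof -
    have "(1 - x) * (\<Sum>k<N. ?a (Suc l) k) = real (Suc l) * x * (\<Sum>k<N. ?a l k) - ?a (Suc l) N"
    proof (induction N)
      case 0
      \<comment> \<open>The boundary term at \<open>N = 0\<close> vanishes: its product contains the
        factor \<open>0 - 0\<close>.\<close>
      show ?case by (simp add: falling_factorial_def) linarith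
    next
      case (Suc N)
      show ?case
        \<comment> \<open>By the recurrence, both sides grow by
          \<open>(1 - x) * ?a (Suc l) N\<close>: the new term of the sum on the right cancels
          against part of the new boundary term.\<close>
        unfolding sum.lessThan_Suc distrib_left Suc.IH falling_factorial_Suc_Suc power_Suc
        by (simp add: algebra_simps)
    qed
    then show ?thesis using x by (simp add: field_simps)
  qed
  have "(\<lambda>N. (real (Suc l) * x * (\<Sum>k<N. ?a l k) - ?a (Suc l) N) / (1 - x)) \<longlonglongrightarrow>
      (real (Suc l) * x * (fact l * x ^ l / (1 - x) ^ Suc l) - 0) / (1 - x)"
    using x Suc.IH[unfolded sums_def]
    by (intro tendsto_intros falling_factorial_times_power_tendsto_0) auto
  then show ?case
    unfolding sums_def partial by (simp add: field_simps)
qed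

theorem theorem5:
  fixes S :: "nat set" and n :: nat
  assumes "S \<subseteq> {1..}"
  shows "summable (\<lambda>k. 1 / 2 ^ k *
           (\<Sum>l=0..n. real (restricted_Stirling S n l) * falling_factorial k l)) \<and>
         real (restricted_Fubini S n) = 1 / 2 * (\<Sum>k. 1 / 2 ^ k *
           (\<Sum>l=0..n. real (restricted_Stirling S n l) * falling_factorial k l))"
proof -
  let ?f = "\<lambda>k. 1 / 2 ^ k * (\<Sum>l=0..n. real (restricted_Stirling S n l) * falling_factorial k l)"
  \<comment> \<open>At \<open>x = 1 / 2\<close> the quotient \<open>x ^ l / (1 - x) ^ Suc l\<close>
    is 2 for every \<open>l\<close>, which the prefactor \<open>1 / 2\<close> of the theorem
    removes.\<close>
  have half: "(\<lambda>k. falling_factorial k l * (1 / 2) ^ k) sums (2 * fact l)" for l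
    using falling_factorial_power_sums[of "1 / 2" l] by (simp add: power_divide mult.commute)
  have "(\<lambda>k. \<Sum>l=0..n. real (restricted_Stirling S n l) * (falling_factorial k l * (1 / 2) ^ k)) sums
      (\<Sum>l=0..n. real (restricted_Stirling S n l) * (2 * fact l))"
    by (intro sums_sum sums_mult half)
  also have "(\<lambda>k. \<Sum>l=0..n. real (restricted_Stirling S n l) * (falling_factorial k l * (1 / 2) ^ k)) = ?f"
    by (simp add: sum_distrib_left power_divide mult_ac)
  also have "(\<Sum>l=0..n. real (restricted_Stirling S n l) * (2 * fact l)) = 2 * real (restricted_Fubini S n)"
    by (simp add: restricted_Fubini_eq_sum sum_distrib_left mult_ac)
  finally show ?thesis
    by (auto simp: sums_iff)
qed

end
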